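(* Let $0<\alpha\le 1$ and let $M_0\ge\sqrt{\alpha^{-1}}$. Consider the limiting piston problem obtained from the modified Chaplygin gas $P=A\rho-B\rho^{-\alpha}$ with $A+B\alpha=2/M_0^2$ as $A\to0$, for the piston rushing into the gas with velocity $v_0=-\sqrt2$: in $\Omega=\{(t,x):x<0,\ t>0\}$, $$\rho_t+(\rho u)_x=0,\qquad (\rho u)_t+(\rho u^2+P)_x=0,\qquad P(\rho)=-\frac{2}{\alpha M_0^2\rho^{\alpha}},$$ with initial condition $(\rho_0,u_0)=(1,\sqrt2)$ and boundary condition $\rho u=0$ on $x=0$. Then the Radon measures $$\tau=I_\Omega L^2+w_\rho(t)\,\delta_{\{x=0,\,t\ge0\}},\qquad m=\sqrt2\,I_\Omega L^2,\qquad n=2\,I_\Omega L^2,\qquad \wp=-\frac{2}{\alpha M_0^2}I_\Omega L^2,$$ with $$w_\rho(t)=\sqrt2\,t,\qquad w_p(t)=2-\frac{2}{\alpha M_0^2}\ \ (\ge0),$$ define a measure solution $(\tau,u,w_p)$ of this limiting piston problem, where $u$ denotes the Radon–Nikodym derivative of $m$ with respect to $\tau$.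
   Context: $L^2$ denotes two-dimensional Lebesgue measure, and $I_\Omega$ the characteristic function of $\Omega$. For a Lipschitz curve $\mathcal L$ given by $x=x(t)$, $t\in[0,T)$, and $w\in L^1_{loc}(0,T)$, the Dirac measure $w\,\delta_{\mathcal L}$ is defined by $\langle w\,\delta_{\mathcal L},\phi\rangle=\int_0^T\phi(t,x(t))\,w(t)\sqrt{x'(t)^2+1}\,dt$ for $\phi\in C_0(\mathbb R^2)$. In particular $\langle w\,\delta_{\{x=0,t\ge0\}},\phi\rangle=\int_0^\infty w(t)\phi(t,0)\,dt$. Measure solution: let $\tau,m,n,\wp$ be Radon measures on $\overline\Omega$ and $w_p$ a locally integrable nonnegative function on $[0,\infty)$. Then $(\tau,u,w_p)$ is called a measure solution of the piston problem with initial data $(\rho_0,u_0)$ and pressure law $P=P(\rho)$ if: (i) $m\ll\tau$ and $n\ll m$ (where $\mu\ll\nu$ means $\nu$ is nonnegative and $\mu$ is absolutely continuous with respect to $\nu$), with the same Radon–Nikodym derivative $u=\frac{dm}{d\tau}=\frac{dn}{dm}$; (ii) for every $\phi\in C_0^1(\mathbb R^2)$, $$\langle\tau,\partial_t\phi\rangle+\langle m,\partial_x\phi\rangle+\int_{-\infty}^0\rho_0\,\phi(0,x)\,dx=0,$$ $$\langle m,\partial_t\phi\rangle+\langle n,\partial_x\phi\rangle+\langle\wp,\partial_x\phi\rangle-\langle w_p\,\delta_{\{x=0,t\ge0\}},\phi\rangle+\int_{-\infty}^0\rho_0u_0\,\phi(0,x)\,dx=0;$$ (iii) if $\tau\ll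 L^2$ with derivative $\rho(t,x)$ in a neighborhood of a point $(t,x)\in[0,\infty)\times(-\infty,0]$ and $\wp\ll L^2$ with derivative $P(t,x)$ there, then $P=P(\rho)$ holds $L^2$-a.e. there, and in addition the classical entropy condition holds for discontinuities of $\rho,u$ near $(t,x)$. *)

theory Defs
  imports "HOL-Analysis.Analysis"
begin

text \<open>Points of the plane are pairs \<open>(t, x)\<close>; two-dimensional Lebesgue measure is \<open>lborel\<close> on
  \<open>real \<times> real\<close>.\<close>

definition Omega :: "(real \<times> real) set" where
  "Omega = {(t, x). x < 0 \<and> t > 0}"


section \<open>Signed Radon measures\<close>

text \<open>A real (signed) Radon measure on the plane is represented by its Jordan decomposition
  (positive part, negative part). Such a measure may be infinite in total variation, so it is not a
  set function on all Borel sets. Mutual singularity makes the representation unique. Inner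
  regularity is automatic for locally finite Borel measures on the plane.\<close>

type_synonym signed_measure = "(real \<times> real) measure \<times> (real \<times> real) measure"

definition radon_measure_on :: "(real \<times> real) set \<Rightarrow> signed_measure \<Rightarrow> bool" where
  "radon_measure_on S \<mu> \<longleftrightarrow>
     (\<forall>\<nu> \<in> {fst \<mu>, snd \<mu>}.
        sets \<nu> = sets borel \<and> (\<forall>K. compact K \<longrightarrow> emeasure \<nu> K < \<infinity>) \<and> emeasure \<nu> (- S) = 0) \<and>
     (\<exists>A \<in> sets borel. emeasure (fst \<mu>) (- A) = 0 \<and> emeasure (snd \<mu>) A = 0)"

definition pairing :: "signed_measure \<Rightarrow> (real \<times> real \<Rightarrow> real) \<Rightarrow> real" where
  "pairing \<mu> \<phi> = (LINT z|fst \<mu>. \<phi> z) - (LINT z|snd \<mu>. \<phi> z)"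

definition nonneg_measure :: "signed_measure \<Rightarrow> bool" where
  "nonneg_measure \<mu> \<longleftrightarrow> emeasure (snd \<mu>) UNIV = 0"

definition measure_sum :: "(real \<times> real) measure \<Rightarrow> (real \<times> real) measure \<Rightarrow> (real \<times> real) measure"
  where "measure_sum M N = measure_of UNIV (sets borel) (\<lambda>E. emeasure M E + emeasure N E)"

text \<open>Componentwise addition gives the Jordan decomposition of the sum only if its two components
  are mutually singular, for instance when both summands are nonnegative.\<close>

definition signed_sum :: "signed_measure \<Rightarrow> signed_measure \<Rightarrow> signed_measure" where
  "signed_sum \<mu> \<nu> = (measure_sum (fst \<mu>) (fst \<nu>), measure_sum (snd \<mu>) (snd \<nu>))"

text \<open>The measure \<open>f L\<^sup>2\<close>; \<open>ennreal\<close> maps negative reals to 0, so the components are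
  \<open>f\<^sup>+ L\<^sup>2\<close> and \<open>f\<^sup>- L\<^sup>2\<close>. The same device is used below.\<close>

definition lebesgue_times :: "(real \<times> real \<Rightarrow> real) \<Rightarrow> signed_measure" where
  "lebesgue_times f =
     (density lborel (\<lambda>z. ennreal (f z)), density lborel (\<lambda>z. ennreal (- f z)))"

text \<open>The weighted Dirac measure on the curve \<open>x = \<xi>(t)\<close>, \<open>0 \<le> t < T\<close>. Its components are
  mutually singular because \<open>t \<mapsto> (t, \<xi> t)\<close> is injective.\<close>

definition dirac_part :: "ereal \<Rightarrow> (real \<Rightarrow> real) \<Rightarrow> (real \<Rightarrow> real) \<Rightarrow> (real \<times> real) measure" where
  "dirac_part T \<xi> w =
     distr (density (restrict_space lborel {t. 0 \<le> t \<and> ereal t < T})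
              (\<lambda>t. ennreal (w t * sqrt ((deriv \<xi> t)\<^sup>2 + 1))))
           borel (\<lambda>t. (t, \<xi> t))"

definition dirac_curve :: "ereal \<Rightarrow> (real \<Rightarrow> real) \<Rightarrow> (real \<Rightarrow> real) \<Rightarrow> signed_measure" where
  "dirac_curve T \<xi> w = (dirac_part T \<xi> w, dirac_part T \<xi> (\<lambda>t. - w t))"

text \<open>\<open>\<mu> \<lless> \<nu>\<close> with Radon-Nikodym derivative \<open>f\<close>, that is, \<open>\<nu> \<ge> 0\<close> and \<open>\<mu> = f \<nu>\<close>.\<close>

definition has_RN_deriv :: "signed_measure \<Rightarrow> signed_measure \<Rightarrow> (real \<times> real \<Rightarrow> real) \<Rightarrow> bool" where
  "has_RN_deriv \<mu> \<nu> f \<longleftrightarrow>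
     nonneg_measure \<nu> \<and> f \<in> borel_measurable borel \<and>
     fst \<mu> = density (fst \<nu>) (\<lambda>z. ennreal (f z)) \<and>
     snd \<mu> = density (fst \<nu>) (\<lambda>z. ennreal (- f z))"

definition restrict_signed :: "(real \<times> real) set \<Rightarrow> signed_measure \<Rightarrow> signed_measure" where
  "restrict_signed U \<mu> = (density (fst \<mu>) (indicator U), density (snd \<mu>) (indicator U))"

text \<open>\<open>\<mu> \<lless> L\<^sup>2\<close> with derivative \<open>f\<close> inside \<open>U\<close>; the values of \<open>f\<close> outside \<open>U\<close> do not
  matter.\<close>

definition has_lebesgue_density_in ::
    "(real \<times> real) set \<Rightarrow> signed_measure \<Rightarrow> (real \<times> real \<Rightarrow> real) \<Rightarrow> bool" where
  "has_lebesgue_density_in U \<mu> f \<longleftrightarrow>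
     has_RN_deriv (restrict_signed U \<mu>) (restrict_signed U (lebesgue_times (\<lambda>_. 1))) f"


section \<open>Test functions\<close>

definition dt :: "(real \<times> real \<Rightarrow> real) \<Rightarrow> real \<times> real \<Rightarrow> real" where
  "dt \<phi> = (\<lambda>(t, x). deriv (\<lambda>s. \<phi> (s, x)) t)"

definition dx :: "(real \<times> real \<Rightarrow> real) \<Rightarrow> real \<times> real \<Rightarrow> real" where
  "dx \<phi> = (\<lambda>(t, x). deriv (\<lambda>y. \<phi> (t, y)) x)"

definition C01 :: "(real \<times> real \<Rightarrow> real) set" where
  "C01 = {\<phi>. (\<forall>z. \<phi> differentiable (at z)) \<and> continuous_on UNIV (dt \<phi>) \<and> continuous_on UNIV (dx \<phi>) \<and>
             compact (closure {z. \<phi> z \<noteq> 0})}"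


section \<open>The classical (Lax) entropy condition\<close>

text \<open>The system \<open>\<rho>\<^sub>t + (\<rho>u)\<^sub>x = 0\<close>, \<open>(\<rho>u)\<^sub>t + (\<rho>u\<^sup>2 + P(\<rho>))\<^sub>x = 0\<close> has the characteristic speeds
  \<open>u \<mp> sqrt (P'(\<rho>))\<close>. States are pairs \<open>(\<rho>, u)\<close>.\<close>

definition char1 :: "(real \<Rightarrow> real) \<Rightarrow> real \<times> real \<Rightarrow> real" where
  "char1 P q = snd q - sqrt (deriv P (fst q))"

definition char2 :: "(real \<Rightarrow> real) \<Rightarrow> real \<times> real \<Rightarrow> real" where
  "char2 P q = snd q + sqrt (deriv P (fst q))"

text \<open>Lax's inequalities for a discontinuity of speed \<open>s\<close> with left state \<open>l\<close> and right state \<open>r\<close>.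
  They are non-strict in the family of the wave so that contact discontinuities, which are the only
  ones for the linearly degenerate law \<open>P = - B / \<rho>\<close>, are admitted.\<close>

definition lax_condition ::
    "(real \<Rightarrow> real) \<Rightarrow> real \<Rightarrow> real \<times> real \<Rightarrow> real \<times> real \<Rightarrow> bool" where
  "lax_condition P s l r \<longleftrightarrow>
     (char1 P r \<le> s \<and> s \<le> char1 P l \<and> s < char2 P r) \<or>
     (char2 P r \<le> s \<and> s \<le> char2 P l \<and> char1 P l < s)"

definition ess_limit ::
    "(real \<times> real \<Rightarrow> real) \<Rightarrow> real \<Rightarrow> real \<times> real \<Rightarrow> (real \<times> real) set \<Rightarrow> bool" where
  "ess_limit f c z S \<longleftrightarrow>
     (\<forall>e > 0. \<exists>d > 0. AE y in lborel. y \<in> S \<inter> ball z d \<longrightarrow> \<bar>f y - c\<bar> < e)"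

text \<open>\<open>(\<rho>, u)\<close> jumps at \<open>(t, x)\<close> from \<open>l\<close> to \<open>r\<close> across a Lipschitz curve of slope \<open>s\<close> through that
  point. Limits are essential because \<open>\<rho>\<close> and \<open>u\<close> are only determined almost everywhere.\<close>

definition jump_at ::
    "(real \<times> real \<Rightarrow> real) \<Rightarrow> (real \<times> real \<Rightarrow> real) \<Rightarrow> real \<times> real \<Rightarrow> real \<Rightarrow>
     real \<times> real \<Rightarrow> real \<times> real \<Rightarrow> bool" where
  "jump_at \<rho> u z s l r \<longleftrightarrow>
     l \<noteq> r \<and>
     (\<exists>\<xi> C d. d > 0 \<and> C-lipschitz_on {fst z - d..fst z + d} \<xi> \<and>
        \<xi> (fst z) = snd z \<and> (\<xi> has_real_derivative s) (at (fst z)) \<and>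
        ess_limit \<rho> (fst l) z {(t, x). \<bar>t - fst z\<bar> < d \<and> x < \<xi> t} \<and>
        ess_limit u (snd l) z {(t, x). \<bar>t - fst z\<bar> < d \<and> x < \<xi> t} \<and>
        ess_limit \<rho> (fst r) z {(t, x). \<bar>t - fst z\<bar> < d \<and> x > \<xi> t} \<and>
        ess_limit u (snd r) z {(t, x). \<bar>t - fst z\<bar> < d \<and> x > \<xi> t})"

text \<open>Jumps to vacuum are excluded: where \<open>\<rho> = 0\<close> neither \<open>u\<close> nor the characteristic speeds are
  determined.\<close>

definition entropy_condition_in ::
    "(real \<times> real) set \<Rightarrow> (real \<Rightarrow> real) \<Rightarrow> (real \<times> real \<Rightarrow> real) \<Rightarrow> (real \<times> real \<Rightarrow> real) \<Rightarrow> bool" where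
  "entropy_condition_in U P \<rho> u \<longleftrightarrow>
     (\<forall>z \<in> U. \<forall>s l r. jump_at \<rho> u z s l r \<and> fst l > 0 \<and> fst r > 0 \<longrightarrow> lax_condition P s l r)"


section \<open>Measure solutions of the piston problem\<close>

text \<open>In the last clause neighborhoods are relative to the closed quadrant, on which the measures
  live; discontinuities are considered at interior points.\<close>

definition measure_solution ::
    "(real \<Rightarrow> real) \<Rightarrow> real \<Rightarrow> real \<Rightarrow> signed_measure \<Rightarrow> signed_measure \<Rightarrow> signed_measure \<Rightarrow> signed_measure \<Rightarrow>
     (real \<times> real \<Rightarrow> real) \<Rightarrow> (real \<Rightarrow> real) \<Rightarrow> bool" where
  "measure_solution P \<rho>0 u0 \<tau> m n \<pp> u wp \<longleftrightarrow>
     radon_measure_on (closure Omega) \<tau> \<and> radon_measure_on (closure Omega) m \<and>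
     radon_measure_on (closure Omega) n \<and> radon_measure_on (closure Omega) \<pp> \<and>
     (\<forall>T. set_integrable lborel {0..T} wp) \<and> (\<forall>t \<ge> 0. wp t \<ge> 0) \<and>
     has_RN_deriv m \<tau> u \<and> has_RN_deriv n m u \<and>
     (\<forall>\<phi> \<in> C01.
        pairing \<tau> (dt \<phi>) + pairing m (dx \<phi>) + (LINT x:{..0}|lborel. \<rho>0 * \<phi> (0, x)) = 0 \<and>
        pairing m (dt \<phi>) + pairing n (dx \<phi>) + pairing \<pp> (dx \<phi>)
          - pairing (dirac_curve \<infinity> (\<lambda>_. 0) wp) \<phi>
          + (LINT x:{..0}|lborel. \<rho>0 * u0 * \<phi> (0, x)) = 0) \<and>
     (\<forall>z V \<rho> p.
        z \<in> {0..} \<times> {..0} \<and> open V \<and> z \<in> V \<and>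
        has_lebesgue_density_in (V \<inter> closure Omega) \<tau> \<rho> \<and>
        has_lebesgue_density_in (V \<inter> closure Omega) \<pp> p \<longrightarrow>
          (AE y in lborel. y \<in> V \<inter> closure Omega \<longrightarrow> p y = P (\<rho> y)) \<and>
          entropy_condition_in (V \<inter> Omega) P \<rho> u)"


section \<open>The pressure law\<close>

definition modified_chaplygin :: "real \<Rightarrow> real \<Rightarrow> real \<Rightarrow> real \<Rightarrow> real" where
  "modified_chaplygin A B \<alpha> \<rho> = A * \<rho> - B * \<rho> powr (- \<alpha>)"

definition limit_pressure :: "real \<Rightarrow> real \<Rightarrow> real \<Rightarrow> real" where
  "limit_pressure \<alpha> M0 \<rho> = - 2 / (\<alpha> * M0\<^sup>2 * \<rho> powr \<alpha>)"

text \<open>\<open>limit_pressure\<close> is the limit of the modified Chaplygin law as \<open>A \<rightarrow> 0\<close> under the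
  normalization \<open>A + B \<alpha> = 2 / M0\<^sup>2\<close>.\<close>

lemma modified_chaplygin_tendsto_limit_pressure:
  fixes B :: "real \<Rightarrow> real" and \<alpha> M0 \<rho> :: real
  assumes "\<alpha> > 0" and "\<And>A. A + B A * \<alpha> = 2 / M0\<^sup>2"
  shows "((\<lambda>A. modified_chaplygin A (B A) \<alpha> \<rho>) \<longlongrightarrow> limit_pressure \<alpha> M0 \<rho>) (at_right 0)"
proof -
  have "B A * \<alpha> = 2 / M0\<^sup>2 - A" for A
    using assms(2)[of A] by linarith
  then have B: "B A = (2 / M0\<^sup>2 - A) / \<alpha>" for A
    using assms(1) by (metis less_irrefl nonzero_mult_div_cancel_right)
  have "((\<lambda>A. A * \<rho> - (2 / M0\<^sup>2 - A) / \<alpha> * \<rho> powr (- \<alpha>))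
          \<longlongrightarrow> 0 * \<rho> - (2 / M0\<^sup>2 - 0) / \<alpha> * \<rho> powr (- \<alpha>)) (at_right 0)"
    using assms(1) by (intro tendsto_intros) auto
  moreover have "0 * \<rho> - (2 / M0\<^sup>2 - 0) / \<alpha> * \<rho> powr (- \<alpha>) = limit_pressure \<alpha> M0 \<rho>"
    by (simp add: limit_pressure_def powr_minus field_simps)
  ultimately show ?thesis
    by (simp add: modified_chaplygin_def B)
qed

end

theory Submission
  imports Defs
begin

text \<open>The Dirac mass on the piston accumulates exactly the mass flux \<open>\<surd>2\<close> that reaches \<open>x = 0\<close>, so
  both conservation laws reduce to Fubini's theorem and the fundamental theorem of calculus on
  half-lines. The axis is \<open>m\<close>-null, hence any Radon-Nikodym derivative \<open>u\<close> equals \<open>\<surd>2\<close> almost everywhere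
  in \<open>Omega\<close>. There \<open>\<rho> = 1\<close> as well, so the entropy condition holds because a constant state has no
  jumps.\<close>

section \<open>Sums of measures\<close>

text \<open>The pair (1, \<open>sqrt 2\<close>) and its pressure fill the whole domain, so all
  interaction sits on the piston. The weight \<open>w\<^sub>p\<close> is the momentum flux \<rho>u^2
  + P arriving there; it is nonnegative exactly when \<alpha> times the square of \<open>M0\<close>
  is at least 1, which the bound on \<open>M0\<close> provides. The Dirac mass makes the derivative
  of \<open>m\<close> by \<open>\<tau>\<close> vanish almost everywhere on the piston, while the
  derivative of \<open>n\<close> by \<open>m\<close> is constrained in \<open>Omega\<close> only;
  this is how a single \<open>u\<close> serves both. Two features of the encoding shape the proof. A
  signed measure is a pair of components cut out by \<open>ennreal\<close>, so identities have to be
  checked for both; several facts are therefore proved for an arbitrary coefficient and used for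
  \<open>c\<close> and \<open>- c\<close>. The clause on pressure and entropy concerns neighborhoods
  in the closed quadrant, which may reach the piston, where \<open>\<tau>\<close> has no Lebesgue
  density. Restriction to \<open>Omega\<close>, an open set missing the axis, removes the Dirac
  mass, and the rest of the closed quadrant is a Lebesgue null set.\<close>

lemma space_measure_sum [simp]: "space (measure_sum M N) = UNIV"
  by (simp add: measure_sum_def)

lemma sets_measure_sum [simp, measurable_cong]: "sets (measure_sum M N) = sets borel"
  using sets.sigma_sets_eq[of "borel :: (real \<times> real) measure"]
  by (simp add: measure_sum_def)

text \<open>\<open>E\<close> may be non-Borel: then both sides are 0 by convention, so this is an
  unconditional rewrite rule.\<close>

lemma emeasure_measure_sum:
  assumes [simp]: "sets M = sets borel" "sets N = sets borel"
  shows "emeasure (measure_sum M N) E = emeasure M E + emeasure N E"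
proof (cases "E \<in> sets borel")
  case True
  show ?thesis
  proof (rule emeasure_measure_of[OF measure_sum_def])
    show "countably_additive (sets (measure_sum M N)) (\<lambda>E. emeasure M E + emeasure N E)"
      by (auto simp: countably_additive_def suminf_add[symmetric] suminf_emeasure)
  qed (use True in \<open>auto simp: positive_def\<close>)
qed (simp add: emeasure_notin_sets)

lemma nn_integral_measure_sum:
  assumes [simp, measurable_cong]: "sets M = sets borel" "sets N = sets borel"
    and "f \<in> borel_measurable borel"
  shows "(\<integral>\<^sup>+z. f z \<partial>measure_sum M N) = (\<integral>\<^sup>+z. f z \<partial>M) + (\<integral>\<^sup>+z. f z \<partial>N)"
  using assms(3)
proof (induction rule: borel_measurable_induct)
  case (cong f g)
  then have "f = g" by auto
  with cong show ?case by simp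
next
  case (set A)
  then show ?case by (simp add: emeasure_measure_sum)
next
  case (mult u c)
  then show ?case by (simp add: nn_integral_cmult distrib_left)
next
  case (add u v)
  then show ?case by (simp add: nn_integral_add ac_simps)
next
  case (seq U)
  have "(\<integral>\<^sup>+z. (SUP i. U i) z \<partial>K) = (SUP i. \<integral>\<^sup>+z. U i z \<partial>K)"
    if [simp, measurable_cong]: "sets K = sets borel" for K
    using seq by (simp add: image_comp nn_integral_monotone_convergence_SUP)
  \<comment> \<open>Suprema of sequences commute with sums when both sequences increase.\<close>
  moreover have "incseq (\<lambda>i. \<integral>\<^sup>+z. U i z \<partial>K)" for K :: "(real \<times> real) measure"
    using seq(3) by (auto simp: incseq_def le_fun_def intro!: nn_integral_mono)
  ultimately show ?case
    using seq by (simp add: ennreal_SUP_add)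
qed

text \<open>Apply the nonnegative case to the positive and negative parts of \<open>f\<close>.
  Integrability makes the four integrals finite, which \<open>enn2real\<close> needs in order to be
  additive.\<close>

lemma integral_measure_sum:
  fixes f :: "real \<times> real \<Rightarrow> real"
  assumes [simp, measurable_cong]: "sets M = sets borel" "sets N = sets borel"
    and M: "integrable M f" and N: "integrable N f"
  shows "(LINT z|measure_sum M N. f z) = (LINT z|M. f z) + (LINT z|N. f z)"
proof -
  have f [measurable]: "f \<in> borel_measurable borel"
    using M by (simp add: measurable_cong_sets[of M borel])
  have fin: "(\<integral>\<^sup>+z. ennreal (f z) \<partial>K) < \<infinity>" "(\<integral>\<^sup>+z. ennreal (- f z) \<partial>K) < \<infinity>"
    if "integrable K f" for K
    using that by (auto simp: real_integrable_def top.not_eq_extremum)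
  have "integrable (measure_sum M N) f"
    using fin[OF M] fin[OF N]
    by (auto simp: real_integrable_def nn_integral_measure_sum)
  then show ?thesis
    using M N fin[OF M] fin[OF N]
    by (simp add: real_lebesgue_integral_def nn_integral_measure_sum enn2real_plus)
qed

lemma density_measure_sum:
  assumes [simp, measurable_cong]: "sets M = sets borel" "sets N = sets borel"
    and [measurable]: "f \<in> borel_measurable borel"
  shows "density (measure_sum M N) f = measure_sum (density M f) (density N f)"
  by (rule measure_eqI) (auto simp: emeasure_density emeasure_measure_sum nn_integral_measure_sum)

lemma measure_sum_null:
  assumes [simp]: "sets M = sets borel" "sets N = sets borel" and "emeasure N UNIV = 0"
  shows "measure_sum M N = M"
proof (rule measure_eqI)
  fix E
  have "emeasure N E \<le> emeasure N UNIV"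
    by (rule emeasure_mono) auto
  then show "emeasure (measure_sum M N) E = emeasure M E"
    using assms by (simp add: emeasure_measure_sum)
qed simp

lemma integral_null_measure:
  fixes f :: "real \<times> real \<Rightarrow> real"
  assumes "sets M = sets borel" "emeasure M UNIV = 0"
  shows "(LINT z|M. f z) = 0"
proof -
  have "space M = UNIV"
    using sets_eq_imp_space_eq[OF assms(1)] by simp
  then have "AE z in M. False"
    using assms by (intro AE_I[of _ _ UNIV]) auto
  then show ?thesis
    by (intro integral_eq_zero_AE) auto
qed

lemma nn_integral_eq_0I: "(\<And>x. f x = 0) \<Longrightarrow> (\<integral>\<^sup>+x. f x \<partial>M) = 0"
  by simp

section \<open>Absolutely continuous parts\<close>

lemma open_Omega: "open Omega"
proof -
  have "Omega = {0<..} \<times> {..<0}"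
    by (auto simp: Omega_def)
  then show ?thesis
    by (metis open_Times open_greaterThan open_lessThan)
qed

lemma Omega_borel [measurable]: "Omega \<in> sets borel"
  using open_Omega by auto

lemma closure_Omega: "closure Omega = {0..} \<times> {..0}"
proof -
  have "Omega = {0<..} \<times> {..<0}"
    by (auto simp: Omega_def)
  show ?thesis
    unfolding \<open>Omega = {0<..} \<times> {..<0}\<close> closure_Times by simp
qed

text \<open>A quadrant is convex, and the frontier of a convex set is negligible.\<close>

lemma AE_closure_Omega: "AE z in lborel. z \<in> closure Omega \<longrightarrow> z \<in> Omega"
proof -
  have *: "Omega = {0<..} \<times> {..<0}"
    by (auto simp: Omega_def)
  have "frontier Omega \<in> null_sets lebesgue"
    unfolding negligible_iff_null_sets[symmetric] *
    by (intro negligible_convex_frontier convex_Times) auto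
  then have "frontier Omega \<in> null_sets lborel"
    by (simp add: null_sets_completion_iff)
  then show ?thesis
    by (rule AE_I') (auto simp: frontier_def interior_open[OF open_Omega])
qed

text \<open>Each component of the measure determines only one part of the derivative: the first
  fixes the positive part, the second the negative part. Together they fix the function.\<close>

lemma has_RN_deriv_unique:
  assumes "has_RN_deriv \<mu> \<nu> f" "has_RN_deriv \<mu> \<nu> g"
    and "sigma_finite_measure (fst \<nu>)" and s [measurable_cong]: "sets (fst \<nu>) = sets borel"
  shows "AE z in fst \<nu>. f z = g z"
proof -
  interpret sigma_finite_measure "fst \<nu>" by fact
  have [measurable]: "f \<in> borel_measurable borel" "g \<in> borel_measurable borel"
    using assms by (auto simp: has_RN_deriv_def)
  have "AE z in fst \<nu>. ennreal (f z) = ennreal (g z)"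
    by (rule density_unique) (use assms in \<open>auto simp: has_RN_deriv_def\<close>)
  moreover have "AE z in fst \<nu>. ennreal (- f z) = ennreal (- g z)"
    by (rule density_unique) (use assms in \<open>auto simp: has_RN_deriv_def\<close>)
  ultimately show ?thesis
  proof eventually_elim
    case (elim z)
    then show ?case
      by (cases "f z \<ge> 0"; cases "g z \<ge> 0") (auto simp: ennreal_eq_0_iff ennreal_neg)
  qed
qed

lemma has_RN_deriv_restrict:
  assumes "has_RN_deriv \<mu> \<nu> f"
    and s [measurable_cong]: "sets (fst \<nu>) = sets borel" "sets (snd \<nu>) = sets borel"
    and [measurable]: "U \<in> sets borel"
  shows "has_RN_deriv (restrict_signed U \<mu>) (restrict_signed U \<nu>) f"
proof -
  have [measurable]: "f \<in> borel_measurable borel"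
    using assms by (auto simp: has_RN_deriv_def)
  have "emeasure (density (snd \<nu>) (indicator U)) UNIV = 0"
  proof -
    from assms have "emeasure (snd \<nu>) UNIV = 0"
      by (simp add: has_RN_deriv_def nonneg_measure_def)
    have "emeasure (snd \<nu>) U \<le> emeasure (snd \<nu>) UNIV"
      by (rule emeasure_mono) (auto simp: s)
    with \<open>emeasure (snd \<nu>) UNIV = 0\<close> have "emeasure (snd \<nu>) U = 0"
      by simp
    then show ?thesis
      by (simp add: emeasure_density)
  qed
  then show ?thesis
    using assms
    by (auto simp: has_RN_deriv_def restrict_signed_def nonneg_measure_def density_density_eq
        mult.commute)
qed

lemma restrict_restrict_signed:
  assumes [measurable_cong]: "sets (fst \<mu>) = sets borel" "sets (snd \<mu>) = sets borel"
    and [measurable]: "U \<in> sets borel" "W \<in> sets borel"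
  shows "restrict_signed W (restrict_signed U \<mu>) = restrict_signed (W \<inter> U) \<mu>"
  by (auto simp: restrict_signed_def density_density_eq intro!: density_cong split: split_indicator)

lemma restrict_lebesgue_times:
  assumes [measurable]: "f \<in> borel_measurable borel" "U \<in> sets borel"
  shows "restrict_signed U (lebesgue_times f) = lebesgue_times (\<lambda>z. f z * indicator U z)"
  unfolding restrict_signed_def lebesgue_times_def fst_conv snd_conv
  by (auto simp: density_density_eq intro!: density_cong split: split_indicator)

lemma sets_lebesgue_times [simp]:
  "sets (fst (lebesgue_times f)) = sets borel" "sets (snd (lebesgue_times f)) = sets borel"
  by (auto simp: lebesgue_times_def)

lemma nonneg_measure_lebesgue_times:
  assumes [measurable]: "f \<in> borel_measurable borel" and "\<And>z. f z \<ge> 0"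
  shows "nonneg_measure (lebesgue_times f)"
  using assms
  by (auto simp: nonneg_measure_def lebesgue_times_def emeasure_density ennreal_neg)

text \<open>As \<open>f\<close> is nonnegative, the positive and negative parts of
  \<open>f z * u z\<close> are \<open>f z\<close> times those of \<open>u z\<close>, so a single
  identity yields both components.\<close>

lemma has_RN_deriv_lebesgue_times:
  assumes [measurable]: "f \<in> borel_measurable borel" "g \<in> borel_measurable borel" "u \<in> borel_measurable borel"
    and nonneg: "\<And>z. f z \<ge> 0" and "AE z in lborel. g z = f z * u z"
  shows "has_RN_deriv (lebesgue_times g) (lebesgue_times f) u"
proof -
  have "AE z in lborel. ennreal (g z) = ennreal (f z) * ennreal (u z)"
    using assms(5) by eventually_elim (simp add: ennreal_mult' nonneg)
  moreover have "AE z in lborel. ennreal (- g z) = ennreal (f z) * ennreal (- u z)"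
    using assms(5) by eventually_elim (simp add: ennreal_mult'[symmetric] nonneg)
  ultimately show ?thesis
    using nonneg_measure_lebesgue_times[of f] nonneg
    by (auto simp: has_RN_deriv_def lebesgue_times_def density_density_eq intro!: density_cong)
qed

text \<open>The constant \<open>c\<close> is another derivative of the same measure, and almost
  everywhere for the reference measure means Lebesgue almost everywhere in \<open>S\<close>. The
  values of \<open>u\<close>, of the density of \<open>\<tau>\<close> and of that of
  \<open>\<pp>\<close> are all found in this way.\<close>

lemma lebesgue_times_deriv_unique:
  assumes [measurable]: "S \<in> sets borel"
    and "has_RN_deriv (lebesgue_times (\<lambda>z. c * indicator S z)) (lebesgue_times (indicator S)) f"
  shows "AE z in lborel. z \<in> S \<longrightarrow> f z = c"
proof -
  have "sigma_finite_measure (density lborel (\<lambda>z. ennreal (indicator S z)))"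
    by (subst sigma_finite_measure.sigma_finite_iff_density_finite[OF sigma_finite_lborel]) auto
  then have "AE z in fst (lebesgue_times (indicator S)). f z = c"
    using has_RN_deriv_unique[OF assms(2) has_RN_deriv_lebesgue_times]
    by (auto simp: lebesgue_times_def)
  then have "AE z in lborel. 0 < ennreal (indicator S z) \<longrightarrow> f z = c"
    unfolding lebesgue_times_def fst_conv by (subst (asm) AE_density) auto
  then show ?thesis
    by eventually_elim (auto split: split_indicator_asm)
qed

lemma radon_measure_on_lebesgue_times:
  assumes [measurable]: "S \<in> sets borel" and "S \<subseteq> T"
  shows "radon_measure_on T (lebesgue_times (\<lambda>z. c * indicator S z))"
proof -
  \<comment> \<open>The coefficients \<open>c\<close> and \<open>- c\<close> give the two
    components.\<close>
  have fin: "emeasure (density lborel (\<lambda>z. ennreal (a * indicator S z))) K < \<infinity>" if "compact K" for a K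
  proof -
    have [measurable]: "K \<in> sets borel"
      using that by (simp add: borel_compact)
    have "emeasure (density lborel (\<lambda>z. ennreal (a * indicator S z))) K
        \<le> (\<integral>\<^sup>+z. ennreal a * indicator K z \<partial>lborel)"
      by (subst emeasure_density) (auto intro!: nn_integral_mono split: split_indicator)
    also have "\<dots> < \<infinity>"
      using emeasure_compact_finite[OF that]
      by (subst nn_integral_cmult_indicator) (auto simp: ennreal_mult_less_top)
    finally show ?thesis .
  qed
  have null: "emeasure (density lborel (\<lambda>z. ennreal (a * indicator S z))) (- T) = 0" for a
  proof (cases "- T \<in> sets borel")
    case True
    then have "emeasure (density lborel (\<lambda>z. ennreal (a * indicator S z))) (- T)
        = (\<integral>\<^sup>+z. ennreal (a * indicator S z) * indicator (- T) z \<partial>lborel)"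
      by (subst emeasure_density) auto
    also have "\<dots> = 0"
      using \<open>S \<subseteq> T\<close> by (intro nn_integral_eq_0I) (auto split: split_indicator)
    finally show ?thesis .
  qed (simp add: emeasure_notin_sets)
  \<comment> \<open>Only one component is nonzero, so the Hahn set is everything or empty, according
    to the sign of \<open>c\<close>.\<close>
  have "\<exists>A \<in> sets borel. emeasure (density lborel (\<lambda>z. ennreal (c * indicator S z))) (- A) = 0 \<and>
      emeasure (density lborel (\<lambda>z. ennreal (- c * indicator S z))) A = 0"
    by (rule bexI[of _ "if c \<ge> 0 then UNIV else {}"])
       (auto simp: emeasure_density ennreal_neg intro!: nn_integral_eq_0I split: split_indicator)
  then show ?thesis
    using fin[of _ c] fin[of _ "- c"] null[of c] null[of "- c"]
    by (auto simp: radon_measure_on_def lebesgue_times_def)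
qed

lemma pairing_lebesgue_times:
  assumes [measurable]: "S \<in> sets borel" "f \<in> borel_measurable borel"
  shows "pairing (lebesgue_times (\<lambda>z. c * indicator S z)) f = c * (LINT z:S|lborel. f z)"
proof -
  \<comment> \<open>\<open>ennreal\<close> cuts the coefficient \<open>a\<close> off at 0; the
    pairing then recovers \<open>c\<close> as \<open>max 0 c - max 0 (- c)\<close>.\<close>
  have *: "(LINT z|density lborel (\<lambda>z. ennreal (a * indicator S z)). f z) =
      max 0 a * (LINT z:S|lborel. f z)" for a
  proof -
    have "(\<lambda>z. ennreal (a * indicator S z)) = (\<lambda>z. ennreal (max 0 a * indicator S z))"
      by (auto simp: fun_eq_iff ennreal_neg max_def split: split_indicator)
    then show ?thesis
      by (simp add: integral_density set_lebesgue_integral_def mult.assoc)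
  qed
  show ?thesis
    using *[of c] *[of "- c"]
    by (auto simp: pairing_def lebesgue_times_def max_def)
qed

section \<open>Weighted Dirac measures on the piston\<close>

text \<open>The curve has slope 0, so its arc-length factor is 1.\<close>

lemma dirac_part_axis:
  "dirac_part \<infinity> (\<lambda>_. 0) w =
    distr (density (restrict_space lborel {0..}) (\<lambda>t. ennreal (w t))) borel (\<lambda>t. (t, 0))"
  by (simp add: dirac_part_def atLeast_def)

lemma sets_dirac_part [simp]: "sets (dirac_part T \<xi> w) = sets borel"
  by (simp add: dirac_part_def)

lemma emeasure_dirac_part_axis:
  assumes [measurable]: "w \<in> borel_measurable borel" "E \<in> sets borel"
  shows "emeasure (dirac_part \<infinity> (\<lambda>_. 0) w) E =
    (\<integral>\<^sup>+t. ennreal (w t) * indicator {t. 0 \<le> t \<and> (t, 0) \<in> E} t \<partial>lborel)"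
proof -
  have [measurable]: "w \<in> borel_measurable (restrict_space lborel {0..})"
    "(\<lambda>t. (t, 0::real)) \<in> measurable (restrict_space lborel {0..}) borel"
    by (auto intro!: measurable_restrict_space1)
  show ?thesis
    unfolding dirac_part_axis
    using measurable_sets[of "\<lambda>t. (t, 0::real)" "restrict_space lborel {0..}" borel E]
    by (simp add: emeasure_distr emeasure_density space_restrict_space)
       (auto intro!: nn_integral_cong simp: nn_integral_restrict_space split: split_indicator)
qed

text \<open>The last hypothesis covers both ways of being null: the axis misses \<open>E\<close>, or
  \<open>ennreal\<close> cuts the weight off. The first is used for \<open>Omega\<close> and for the
  outside of its closure, the second for negative components.\<close>

lemma dirac_part_axis_null:
  assumes [measurable]: "w \<in> borel_measurable borel" and "E \<in> sets borel"
    and "\<And>t. t \<ge> 0 \<Longrightarrow> (t, 0) \<in> E \<Longrightarrow> w t \<le> 0"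
  shows "emeasure (dirac_part \<infinity> (\<lambda>_. 0) w) E = 0"
  using assms
  by (subst emeasure_dirac_part_axis)
     (auto intro!: nn_integral_eq_0I simp: ennreal_neg split: split_indicator)

lemma integral_dirac_part_axis:
  fixes f :: "real \<times> real \<Rightarrow> real"
  assumes [measurable]: "w \<in> borel_measurable borel" "f \<in> borel_measurable borel"
    and "\<And>t. t \<ge> 0 \<Longrightarrow> w t \<ge> 0"
  shows "(LINT z|dirac_part \<infinity> (\<lambda>_. 0) w. f z) = (LINT t:{0..}|lborel. w t * f (t, 0))"
    and "integrable (dirac_part \<infinity> (\<lambda>_. 0) w) f \<longleftrightarrow> set_integrable lborel {0..} (\<lambda>t. w t * f (t, 0))"
proof -
  have [measurable]: "w \<in> borel_measurable (restrict_space lborel {0..})"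
    "(\<lambda>t. (t, 0::real)) \<in> measurable (restrict_space lborel {0..}) borel"
    "(\<lambda>t. f (t, 0)) \<in> borel_measurable (restrict_space lborel {0..})"
    by (auto intro!: measurable_restrict_space1)
  have ae: "AE t in restrict_space lborel {0..}. 0 \<le> w t"
    using assms(3) by (auto simp: AE_restrict_space_iff)
  show "(LINT z|dirac_part \<infinity> (\<lambda>_. 0) w. f z) = (LINT t:{0..}|lborel. w t * f (t, 0))"
    unfolding dirac_part_axis
    by (simp add: integral_distr integral_density ae integral_restrict_space
        set_lebesgue_integral_def)
  show "integrable (dirac_part \<infinity> (\<lambda>_. 0) w) f \<longleftrightarrow>
      set_integrable lborel {0..} (\<lambda>t. w t * f (t, 0))"
    unfolding dirac_part_axis
    by (simp add: integrable_distr_eq integrable_density ae integrable_restrict_space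
        set_integrable_def)
qed

lemma pairing_dirac_curve_axis:
  assumes [measurable]: "w \<in> borel_measurable borel" "f \<in> borel_measurable borel"
    and "\<And>t. t \<ge> 0 \<Longrightarrow> w t \<ge> 0"
  shows "pairing (dirac_curve \<infinity> (\<lambda>_. 0) w) f = (LINT t:{0..}|lborel. w t * f (t, 0))"
proof -
  have "emeasure (dirac_part \<infinity> (\<lambda>_. 0) (\<lambda>t. - w t)) UNIV = 0"
    using assms by (intro dirac_part_axis_null) auto
  then show ?thesis
    using assms
    by (simp add: pairing_def dirac_curve_def integral_dirac_part_axis integral_null_measure)
qed

lemma nonneg_measure_dirac_curve_axis:
  assumes [measurable]: "w \<in> borel_measurable borel" and "\<And>t. t \<ge> 0 \<Longrightarrow> w t \<ge> 0"
  shows "nonneg_measure (dirac_curve \<infinity> (\<lambda>_. 0) w)"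
  unfolding nonneg_measure_def dirac_curve_def snd_conv
  using assms by (intro dirac_part_axis_null) auto

lemma nonneg_measure_signed_sum:
  assumes "radon_measure_on S \<mu>" "radon_measure_on S \<nu>" "nonneg_measure \<mu>" "nonneg_measure \<nu>"
  shows "nonneg_measure (signed_sum \<mu> \<nu>)"
  using assms by (simp add: nonneg_measure_def signed_sum_def emeasure_measure_sum radon_measure_on_def)

lemma radon_measure_on_signed_sum:
  assumes "radon_measure_on S \<mu>" "radon_measure_on S \<nu>" "nonneg_measure \<mu>" "nonneg_measure \<nu>"
  shows "radon_measure_on S (signed_sum \<mu> \<nu>)"
  unfolding radon_measure_on_def
proof
  show "\<exists>A \<in> sets borel. emeasure (fst (signed_sum \<mu> \<nu>)) (- A) = 0 \<and>
      emeasure (snd (signed_sum \<mu> \<nu>)) A = 0"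
    using nonneg_measure_signed_sum[OF assms]
    by (intro bexI[of _ UNIV]) (auto simp: nonneg_measure_def)
qed (use assms in \<open>auto simp: radon_measure_on_def signed_sum_def emeasure_measure_sum\<close>)

text \<open>A compact set meets the axis only at bounded \<open>t\<close>, where a continuous weight
  is bounded; this gives local finiteness.\<close>

lemma radon_measure_on_dirac_curve_axis:
  assumes cont: "continuous_on UNIV w" and nonneg: "\<And>t. t \<ge> 0 \<Longrightarrow> w t \<ge> 0"
  shows "radon_measure_on (closure Omega) (dirac_curve \<infinity> (\<lambda>_. 0) w)"
proof -
  have [measurable]: "v \<in> borel_measurable borel" if "continuous_on UNIV v" for v :: "real \<Rightarrow> real"
    using that by (rule borel_measurable_continuous_onI)
  have fin: "emeasure (dirac_part \<infinity> (\<lambda>_. 0) v) K < \<infinity>"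
    if K: "compact K" and v: "continuous_on UNIV v" for v K
  proof -
    have [measurable]: "K \<in> sets borel" "v \<in> borel_measurable borel"
      using K v by (auto simp: borel_compact borel_measurable_continuous_onI)
    obtain R where R: "norm z \<le> R" if "z \<in> K" for z
      using compact_imp_bounded[OF K] by (auto simp: bounded_iff)
    have "compact (v ` {0..R})"
      using v by (intro compact_continuous_image) (auto intro: continuous_on_subset)
    then obtain C where C: "\<bar>v t\<bar> \<le> C" if "t \<in> {0..R}" for t
      using compact_imp_bounded by (force simp: bounded_iff)
    have *: "t \<le> R" if "0 \<le> t" "(t, 0) \<in> K" for t
      using R[OF that(2)] that(1) by (simp add: norm_Pair)
    have le: "ennreal (v t) * indicator {t. 0 \<le> t \<and> (t, 0) \<in> K} t \<le> ennreal C * indicator {0..R} t" for t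
    proof (cases "0 \<le> t \<and> (t, 0) \<in> K")
      case True
      then have t: "t \<in> {0..R}"
        using * by simp
      then show ?thesis
        using True C[OF t] by (simp add: abs_le_iff ennreal_leI)
    qed simp
    have "emeasure (dirac_part \<infinity> (\<lambda>_. 0) v) K
        \<le> (\<integral>\<^sup>+t. ennreal C * indicator {0..R} t \<partial>lborel)"
      by (subst emeasure_dirac_part_axis) (rule \<open>K \<in> sets borel\<close> \<open>v \<in> borel_measurable borel\<close> nn_integral_mono le)+
    also have "\<dots> < \<infinity>"
      by (subst nn_integral_cmult_indicator) (auto simp: ennreal_mult_less_top emeasure_lborel_Icc_eq)
    finally show ?thesis .
  qed
  have null: "emeasure (dirac_part \<infinity> (\<lambda>_. 0) v) (- closure Omega) = 0" if "continuous_on UNIV v" for v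
  proof (rule dirac_part_axis_null)
    show "v t \<le> 0" if "t \<ge> 0" "(t, 0) \<in> - closure Omega" for t
      using that by (simp add: closure_Omega)
  qed (use that in auto)
  have "continuous_on UNIV (\<lambda>t. - w t)"
    using cont by (intro continuous_intros)
  moreover have "emeasure (dirac_part \<infinity> (\<lambda>_. 0) (\<lambda>t. - w t)) UNIV = 0"
    using cont nonneg by (intro dirac_part_axis_null) auto
  ultimately show ?thesis
    using fin[OF _ cont] fin null[OF cont] null
    by (auto simp: radon_measure_on_def dirac_curve_def intro!: bexI[of _ UNIV])
qed

text \<open>The negative components are null. Integrability excludes the default value 0 of the
  integral, for which additivity could fail.\<close>

lemma pairing_signed_sum:
  assumes "radon_measure_on S \<mu>" "radon_measure_on S \<nu>" "nonneg_measure \<mu>" "nonneg_measure \<nu>"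
    and f: "f \<in> borel_measurable borel" and "integrable (fst \<mu>) f" "integrable (fst \<nu>) f"
  shows "pairing (signed_sum \<mu> \<nu>) f = pairing \<mu> f + pairing \<nu> f"
  using assms(1-4) integral_measure_sum[OF _ _ assms(6,7)]
  by (simp add: radon_measure_on_def nonneg_measure_def pairing_def signed_sum_def
      integral_null_measure emeasure_measure_sum)

section \<open>Integrals of derivatives of test functions\<close>

text \<open>Each half-line integral is one over a bounded interval, and in the fundamental theorem
  only the endpoint 0 contributes.\<close>

lemma set_integral_half_line_deriv:
  fixes F f :: "real \<Rightarrow> real"
  assumes deriv: "\<And>t. (F has_real_derivative f t) (at t)" and cont: "continuous_on UNIV f"
    and R: "\<And>t. \<bar>t\<bar> \<ge> R \<Longrightarrow> F t = 0" "\<And>t. \<bar>t\<bar> \<ge> R \<Longrightarrow> f t = 0"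
  shows "set_integrable lborel {0..} f" "(LINT t:{0..}|lborel. f t) = - F 0"
    and "set_integrable lborel {..0} f" "(LINT t:{..0}|lborel. f t) = F 0"
proof -
  \<comment> \<open>\<open>R\<close> may be negative, but \<open>{0..r}\<close> and
    \<open>{-r..0}\<close> must be proper intervals.\<close>
  define r where "r = max 0 R"
  have c: "isCont f t" for t
    using cont by (simp add: continuous_on_eq_continuous_at)
  have r: "F t = 0" "f t = 0" if "\<bar>t\<bar> \<ge> r" for t
    using R that by (auto simp: r_def)
  have r0: "0 \<le> r" "- r \<le> 0"
    by (auto simp: r_def)
  have 1: "(\<lambda>t. f t * indicator {0..r} t) = (\<lambda>t. indicator {0..} t *\<^sub>R f t)"
    and 2: "(\<lambda>t. f t * indicator {-r..0} t) = (\<lambda>t. indicator {..0} t *\<^sub>R f t)"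
    using r by (auto simp: fun_eq_iff split: split_indicator)
  have "has_bochner_integral lborel (\<lambda>t. f t * indicator {0..r} t) (F r - F 0)"
    using deriv c by (intro has_bochner_integral_FTC_Icc_real[OF r0(1)])
  then show "set_integrable lborel {0..} f" "(LINT t:{0..}|lborel. f t) = - F 0"
    using r0 unfolding 1
    by (auto simp: set_integrable_def set_lebesgue_integral_def has_bochner_integral_iff r)
  have "has_bochner_integral lborel (\<lambda>t. f t * indicator {-r..0} t) (F 0 - F (- r))"
    using deriv c by (intro has_bochner_integral_FTC_Icc_real[OF r0(2)])
  then show "set_integrable lborel {..0} f" "(LINT t:{..0}|lborel. f t) = F 0"
    using r0 unfolding 2
    by (auto simp: set_integrable_def set_lebesgue_integral_def has_bochner_integral_iff r)
qed

lemma integrable_compact_support: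
  fixes f :: "'a::euclidean_space \<Rightarrow> real"
  assumes "continuous_on UNIV f" "compact K" "\<And>z. z \<notin> K \<Longrightarrow> f z = 0"
  shows "integrable lborel f"
proof -
  have "integrable lborel (\<lambda>z. indicator K z *\<^sub>R f z)"
    using assms by (intro borel_integrable_compact) (auto intro: continuous_on_subset)
  moreover have "(\<lambda>z. indicator K z *\<^sub>R f z) = f"
    using assms(3) by (auto simp: fun_eq_iff split: split_indicator)
  ultimately show ?thesis by simp
qed

text \<open>Both orders are needed, since the inner variable has to be the one of differentiation:
  \<open>t\<close> for \<open>dt \<phi>\<close> and \<open>x\<close> for
  \<open>dx \<phi>\<close>.\<close>

lemma integral_Omega:
  fixes f :: "real \<times> real \<Rightarrow> real"
  assumes "integrable lborel f"
  shows "(LINT z:Omega|lborel. f z) = (LINT x:{..0}|lborel. LINT t:{0..}|lborel. f (t, x))"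
    and "(LINT z:Omega|lborel. f z) = (LINT t:{0..}|lborel. LINT x:{..0}|lborel. f (t, x))"
proof -
  have C [measurable]: "closure Omega \<in> sets borel"
    by simp
  have [measurable]: "f \<in> borel_measurable borel"
    using assms by auto
  let ?g = "\<lambda>t x. indicator {0..} t * (indicator {..0} x * f (t, x))"
  have g: "(\<lambda>z. indicator (closure Omega) z *\<^sub>R f z) = case_prod ?g"
    by (auto simp: fun_eq_iff closure_Omega split: split_indicator)
  have int: "integrable (lborel \<Otimes>\<^sub>M lborel) (case_prod ?g)"
    unfolding g[symmetric] lborel_prod using assms by (intro integrable_mult_indicator) auto
  \<comment> \<open>The closed quadrant is preferred because the initial term and the Dirac pairing
    are integrals over closed half-lines.\<close>
  have "(LINT z:Omega|lborel. f z) = (LINT z:closure Omega|lborel. f z)"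
    using AE_closure_Omega closure_subset[of Omega]
    by (intro set_integral_cong_set) (auto simp: set_borel_measurable_def)
  also have "\<dots> = integral\<^sup>L (lborel \<Otimes>\<^sub>M lborel) (case_prod ?g)"
    unfolding set_lebesgue_integral_def g lborel_prod ..
  finally have *: "(LINT z:Omega|lborel. f z) = integral\<^sup>L (lborel \<Otimes>\<^sub>M lborel) (case_prod ?g)" .
  show "(LINT z:Omega|lborel. f z) = (LINT t:{0..}|lborel. LINT x:{..0}|lborel. f (t, x))"
    unfolding * lborel_pair.integral_fst'[OF int, symmetric]
    by (simp add: set_lebesgue_integral_def)
  show "(LINT z:Omega|lborel. f z) = (LINT x:{..0}|lborel. LINT t:{0..}|lborel. f (t, x))"
    unfolding * lborel_pair.integral_snd[OF int, symmetric]
    by (simp add: set_lebesgue_integral_def mult.left_commute[of "indicator {0..} _"])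
qed

text \<open>\<open>dt\<close> and \<open>dx\<close> are defined by \<open>deriv\<close>, which is
  meaningful only where the sections are differentiable; that follows from total differentiability
  by the chain rule.\<close>

lemma C01_partial_derivs:
  assumes "\<phi> \<in> C01"
  shows "((\<lambda>s. \<phi> (s, x)) has_real_derivative dt \<phi> (t, x)) (at t)"
    and "((\<lambda>y. \<phi> (t, y)) has_real_derivative dx \<phi> (t, x)) (at x)"
proof -
  have d: "\<phi> differentiable (at z)" for z
    using assms unfolding C01_def by blast
  have "(\<lambda>s. \<phi> (s, x)) differentiable (at t)"
    by (rule differentiable_compose[OF d, of "\<lambda>s. (s, x)"])
       (auto simp: differentiable_def intro!: exI derivative_eq_intros)
  then show "((\<lambda>s. \<phi> (s, x)) has_real_derivative dt \<phi> (t, x)) (at t)"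
    by (simp add: dt_def DERIV_deriv_iff_real_differentiable)
  have "(\<lambda>y. \<phi> (t, y)) differentiable (at x)"
    by (rule differentiable_compose[OF d, of "\<lambda>y. (t, y)"])
       (auto simp: differentiable_def intro!: exI derivative_eq_intros)
  then show "((\<lambda>y. \<phi> (t, y)) has_real_derivative dx \<phi> (t, x)) (at x)"
    by (simp add: dx_def DERIV_deriv_iff_real_differentiable)
qed

lemma C01_support:
  assumes "\<phi> \<in> C01"
  obtains R where
    "\<And>t x. \<bar>t\<bar> \<ge> R \<or> \<bar>x\<bar> \<ge> R \<Longrightarrow> \<phi> (t, x) = 0 \<and> dt \<phi> (t, x) = 0 \<and> dx \<phi> (t, x) = 0"
proof -
  have "bounded {z. \<phi> z \<noteq> 0}"
    using assms by (auto simp: C01_def intro: bounded_subset[OF compact_imp_bounded closure_subset])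
  then obtain B where B: "norm z \<le> B" if "\<phi> z \<noteq> 0" for z
    by (auto simp: bounded_iff)
  have zero: "\<phi> (t, x) = 0" if "\<bar>t\<bar> > B \<or> \<bar>x\<bar> > B" for t x
    using B[of "(t, x)"] that norm_fst_le[of t x] norm_snd_le[of x t]
    by (cases "\<phi> (t, x) = 0") auto
  \<comment> \<open>The margin 1 makes the sections of \<phi> vanish on a neighborhood, as is needed
    for their derivatives to vanish.\<close>
  have "\<phi> (t, x) = 0 \<and> dt \<phi> (t, x) = 0 \<and> dx \<phi> (t, x) = 0" if tx: "\<bar>t\<bar> \<ge> B + 1 \<or> \<bar>x\<bar> \<ge> B + 1" for t x
  proof -
    have "\<forall>\<^sub>F s in nhds t. \<phi> (s, x) = 0"
      using tx by (auto simp: eventually_nhds_metric dist_real_def intro!: exI[of _ "1::real"] zero)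
    then have 1: "deriv (\<lambda>s. \<phi> (s, x)) t = deriv (\<lambda>_. 0) t"
      by (intro deriv_cong_ev) auto
    have "\<forall>\<^sub>F y in nhds x. \<phi> (t, y) = 0"
      using tx by (auto simp: eventually_nhds_metric dist_real_def intro!: exI[of _ "1::real"] zero)
    then have 2: "deriv (\<lambda>y. \<phi> (t, y)) x = deriv (\<lambda>_. 0) x"
      by (intro deriv_cong_ev) auto
    show ?thesis
      using 1 2 tx zero[of t x] by (auto simp: dt_def dx_def)
  qed
  then show thesis
    using that by blast
qed

lemma C01_continuous:
  assumes "\<phi> \<in> C01"
  shows "continuous_on UNIV \<phi>" "continuous_on UNIV (dt \<phi>)" "continuous_on UNIV (dx \<phi>)"
  using assms
  by (auto simp: C01_def intro!: differentiable_imp_continuous_on simp: differentiable_on_def)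

text \<open>These are the integrals to which the weak equations reduce. The last one is integration
  by parts against the linearly growing Dirac weight.\<close>

lemma C01_integrals:
  assumes \<phi>: "\<phi> \<in> C01"
  shows "integrable lborel (dt \<phi>)" "integrable lborel (dx \<phi>)"
    and "(LINT z:Omega|lborel. dt \<phi> z) = - (LINT x:{..0}|lborel. \<phi> (0, x))"
    and "(LINT z:Omega|lborel. dx \<phi> z) = (LINT t:{0..}|lborel. \<phi> (t, 0))"
    and "set_integrable lborel {0..} (\<lambda>t. t * dt \<phi> (t, 0))"
    and "(LINT t:{0..}|lborel. t * dt \<phi> (t, 0)) = - (LINT t:{0..}|lborel. \<phi> (t, 0))"
proof -
  obtain R where R: "\<And>t x. \<bar>t\<bar> \<ge> R \<or> \<bar>x\<bar> \<ge> R \<Longrightarrow> \<phi> (t, x) = 0 \<and> dt \<phi> (t, x) = 0 \<and> dx \<phi> (t, x) = 0"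
    using C01_support[OF \<phi>] by metis
  note deriv = C01_partial_derivs[OF \<phi>] and cont = C01_continuous[OF \<phi>]
  have cont_t: "continuous_on UNIV (\<lambda>t. g (t, x))" and cont_x: "continuous_on UNIV (\<lambda>x. g (t, x))"
    if "continuous_on UNIV g" for g :: "real \<times> real \<Rightarrow> real" and t x
    by (rule continuous_on_compose2[OF that]; auto intro!: continuous_intros)+
  note cont' = cont_t[OF cont(1)] cont_t[OF cont(2)] cont_x[OF cont(3)]
  have K: "compact ({-R..R} \<times> {-R..R})"
    by (intro compact_Times) auto
  have K0: "dt \<phi> z = 0 \<and> dx \<phi> z = 0" if "z \<notin> {-R..R} \<times> {-R..R}" for z
  proof -
    have "R \<le> \<bar>fst z\<bar> \<or> R \<le> \<bar>snd z\<bar>"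
      using that by (cases z) auto
    then show ?thesis
      using R[of "fst z" "snd z"] by simp
  qed
  show I: "integrable lborel (dt \<phi>)" "integrable lborel (dx \<phi>)"
    using K0 by (intro integrable_compact_support[OF _ K] cont; blast)+
  have "(LINT t:{0..}|lborel. dt \<phi> (t, x)) = - \<phi> (0, x)" for x
    using R by (intro set_integral_half_line_deriv(2)[of "\<lambda>t. \<phi> (t, x)" _ R] deriv cont') auto
  then show "(LINT z:Omega|lborel. dt \<phi> z) = - (LINT x:{..0}|lborel. \<phi> (0, x))"
    unfolding integral_Omega(1)[OF I(1)] by (simp add: set_lebesgue_integral_def)
  have "(LINT x:{..0}|lborel. dx \<phi> (t, x)) = \<phi> (t, 0)" for t
    using R by (intro set_integral_half_line_deriv(4)[of "\<lambda>x. \<phi> (t, x)" _ R] deriv cont') auto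
  then show "(LINT z:Omega|lborel. dx \<phi> z) = (LINT t:{0..}|lborel. \<phi> (t, 0))"
    unfolding integral_Omega(2)[OF I(2)] by simp
  have R0: "\<phi> (t, 0) = 0" "dt \<phi> (t, 0) = 0" if "t \<notin> {-R..R}" for t
  proof -
    have "R \<le> \<bar>t\<bar>"
      using that by auto
    then show "\<phi> (t, 0) = 0" "dt \<phi> (t, 0) = 0"
      using R[of t 0] by auto
  qed
  have "integrable lborel (\<lambda>t. \<phi> (t, 0))"
    using R0 by (intro integrable_compact_support[of _ "{-R..R}"] cont') auto
  then have P: "set_integrable lborel {0..} (\<lambda>t. \<phi> (t, 0))"
    unfolding set_integrable_def by (intro integrable_mult_indicator) simp_all
  have "integrable lborel (\<lambda>t. t * dt \<phi> (t, 0))"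
    using R0 by (intro integrable_compact_support[of _ "{-R..R}"] continuous_on_mult continuous_on_id cont') auto
  then show T: "set_integrable lborel {0..} (\<lambda>t. t * dt \<phi> (t, 0))"
    unfolding set_integrable_def by (intro integrable_mult_indicator) simp_all
  \<comment> \<open>The boundary term at \<open>t = 0\<close> vanishes: the piston starts without
    accumulated mass.\<close>
  have "(LINT t:{0..}|lborel. \<phi> (t, 0) + t * dt \<phi> (t, 0)) = - (0 * \<phi> (0, 0))"
  proof (rule set_integral_half_line_deriv(2)
        [of "\<lambda>t. t * \<phi> (t, 0)" "\<lambda>t. \<phi> (t, 0) + t * dt \<phi> (t, 0)" R])
    show "continuous_on UNIV (\<lambda>t. \<phi> (t, 0) + t * dt \<phi> (t, 0))"
      by (intro continuous_on_add continuous_on_mult continuous_on_id cont')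
    show "((\<lambda>t. t * \<phi> (t, 0)) has_real_derivative \<phi> (t, 0) + t * dt \<phi> (t, 0)) (at t)" for t
      using DERIV_mult[OF DERIV_ident[of "at t"] deriv(1)[of 0 t]]
      by (simp add: mult.commute[of _ t])
    show "t * \<phi> (t, 0) = 0" "\<phi> (t, 0) + t * dt \<phi> (t, 0) = 0" if "R \<le> \<bar>t\<bar>" for t
      using R[of t 0] that by simp_all
  qed
  then show "(LINT t:{0..}|lborel. t * dt \<phi> (t, 0)) = - (LINT t:{0..}|lborel. \<phi> (t, 0))"
    using set_integral_add(2)[OF P T] by simp
qed

section \<open>Radon-Nikodym derivatives and one-sided limits\<close>

lemma emeasure_density_null:
  assumes s [measurable_cong]: "sets N = sets borel" and "emeasure N A = 0" and [measurable]: "A \<in> sets borel"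
    and [measurable]: "f \<in> borel_measurable borel" and "\<And>z. z \<notin> A \<Longrightarrow> f z = 0"
  shows "emeasure (density N f) UNIV = 0"
proof -
  have "AE z in N. f z = 0"
    using assms by (intro AE_I[of _ _ A]) auto
  then have "(\<integral>\<^sup>+z. f z \<partial>N) = 0"
    by (subst nn_integral_0_iff_AE) auto
  then show ?thesis
    using sets.top[of N] sets_eq_imp_space_eq[OF s] by (simp add: emeasure_density s)
qed

lemma dirac_part_axis_Omega:
  assumes "w \<in> borel_measurable borel"
  shows "emeasure (dirac_part \<infinity> (\<lambda>_. 0) w) Omega = 0"
proof (rule dirac_part_axis_null[OF assms Omega_borel])
  show "w t \<le> 0" if "(t, 0) \<in> Omega" for t
    using that by (simp add: Omega_def)
qed

text \<open>The Dirac part lives on the axis, outside \<open>Omega\<close>, where \<open>g\<close>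
  is zero. With \<open>g\<close> a derivative or an indicator this serves differentiation and
  localization alike.\<close>

lemma density_sum_dirac_axis:
  assumes [measurable]: "w \<in> borel_measurable borel" "f \<in> borel_measurable borel" "g \<in> borel_measurable borel"
    and "\<And>z. z \<notin> Omega \<Longrightarrow> g z = 0"
  shows "density (measure_sum (density lborel f) (dirac_part \<infinity> (\<lambda>_. 0) w)) g =
    density lborel (\<lambda>z. f z * g z)"
proof -
  have "emeasure (density (dirac_part \<infinity> (\<lambda>_. 0) w) g) UNIV = 0"
    using assms(4) by (intro emeasure_density_null[where A = Omega] dirac_part_axis_Omega) auto
  then show ?thesis
    by (simp add: density_measure_sum measure_sum_null density_density_eq)
qed

text \<open>The derivative must be 0 on the axis, which the sum may charge and the left measure does
  not.\<close>

lemma has_RN_deriv_sum_dirac_axis: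
  assumes [measurable]: "w \<in> borel_measurable borel" and "\<And>t. t \<ge> 0 \<Longrightarrow> w t \<ge> 0"
  shows "has_RN_deriv (lebesgue_times (\<lambda>z. c * indicator Omega z))
    (signed_sum (lebesgue_times (indicator Omega)) (dirac_curve \<infinity> (\<lambda>_. 0) w))
    (\<lambda>z. c * indicator Omega z)"
proof -
  let ?\<mu> = "lebesgue_times (indicator Omega)" and ?\<nu> = "dirac_curve \<infinity> (\<lambda>_. 0) w"
  have *: "density (fst (signed_sum ?\<mu> ?\<nu>)) (\<lambda>z. ennreal (a * indicator Omega z)) =
      density lborel (\<lambda>z. ennreal (a * indicator Omega z))" for a
    unfolding signed_sum_def lebesgue_times_def dirac_curve_def fst_conv
    by (subst density_sum_dirac_axis) (auto intro!: density_cong split: split_indicator)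
  have "nonneg_measure (signed_sum ?\<mu> ?\<nu>)"
    using assms nonneg_measure_lebesgue_times[of "indicator Omega"] nonneg_measure_dirac_curve_axis[of w]
    by (simp add: nonneg_measure_def signed_sum_def emeasure_measure_sum dirac_curve_def)
  then show ?thesis
    using *[of c] *[of "- c"] by (simp add: has_RN_deriv_def) (simp add: lebesgue_times_def)
qed

text \<open>Used with \<open>W = Omega\<close> to identify \<open>u\<close>, and with the part of a
  neighborhood inside \<open>Omega\<close> to identify the density of \<open>\<tau>\<close>.\<close>

lemma restrict_sum_dirac_axis:
  assumes [measurable]: "w \<in> borel_measurable borel" "f \<in> borel_measurable borel" "W \<in> sets borel"
    and "W \<subseteq> Omega"
  shows "restrict_signed W (signed_sum (lebesgue_times f) (dirac_curve \<infinity> (\<lambda>_. 0) w)) =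
    lebesgue_times (\<lambda>z. f z * indicator W z)"
proof -
  have "indicator W z = (0 :: ennreal)" if "z \<notin> Omega" for z
    using that assms(4) by (auto split: split_indicator)
  then show ?thesis
    unfolding restrict_signed_def signed_sum_def lebesgue_times_def dirac_curve_def fst_conv snd_conv
    by (subst (1 2) density_sum_dirac_axis) (auto intro!: density_cong split: split_indicator)
qed

lemma has_lebesgue_density_in_subset:
  assumes "has_lebesgue_density_in U \<mu> f" and [measurable_cong]: "sets (fst \<mu>) = sets borel" "sets (snd \<mu>) = sets borel"
    and [measurable]: "U \<in> sets borel" "W \<in> sets borel" and "W \<subseteq> U"
  shows "has_RN_deriv (restrict_signed W \<mu>) (lebesgue_times (indicator W)) f"
proof -
  have "has_RN_deriv (restrict_signed W (restrict_signed U \<mu>))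
      (restrict_signed W (restrict_signed U (lebesgue_times (\<lambda>_. 1)))) f"
    using assms(1) unfolding has_lebesgue_density_in_def
    by (rule has_RN_deriv_restrict) (auto simp: restrict_signed_def)
  moreover have "W \<inter> U = W" "U \<inter> W = W"
    using assms(6) by auto
  ultimately show ?thesis
    by (simp add: restrict_restrict_signed assms(2,3) restrict_lebesgue_times indicator_inter_arith[symmetric])
qed

text \<open>Every neighborhood of a closure point meets \<open>S\<close>, and a nonempty open set
  has positive measure. On it \<open>f\<close> would be both equal to \<open>k\<close> and closer to
  \<open>c\<close> than \<open>k\<close> is.\<close>

lemma ess_limit_const:
  assumes "ess_limit f c z S" and ae: "AE y in lborel. y \<in> U \<longrightarrow> f y = k"
    and "open U" "z \<in> U" "open S" "z \<in> closure S"
  shows "c = k"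
proof (rule ccontr)
  assume "c \<noteq> k"
  then have "\<bar>k - c\<bar> > 0" by simp
  with assms(1) obtain d where d: "d > 0"
    and f: "AE y in lborel. y \<in> S \<inter> ball z d \<longrightarrow> \<bar>f y - c\<bar> < \<bar>k - c\<bar>"
    unfolding ess_limit_def by blast
  define W where "W = S \<inter> (ball z d \<inter> U)"
  have W: "open W"
    using assms by (auto simp: W_def)
  have "W \<noteq> {}"
    using assms(3,4,6) d open_Int_closure_eq_empty[of "ball z d \<inter> U" S] open_Int[OF open_ball assms(3)]
    unfolding W_def by (metis IntI Int_commute centre_in_ball empty_iff)
  have "AE y in lborel. y \<notin> W"
    using f ae by eventually_elim (auto simp: W_def)
  then have "W \<in> null_sets lborel"
    using W by (simp add: AE_iff_null_sets)
  then have "negligible W"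
    by (simp add: negligible_iff_null_sets null_sets_completionI)
  with open_not_negligible[OF W \<open>W \<noteq> {}\<close>] show False by simp
qed

text \<open>Both sides of the curve are open with \<open>z\<close> in their closures, so all
  one-sided limits are the constants \<open>a\<close> and \<open>b\<close>. Then
  \<open>l = r\<close>, which a jump forbids.\<close>

lemma entropy_condition_in_const:
  assumes "open U" and \<rho>: "AE y in lborel. y \<in> U \<longrightarrow> \<rho> y = a" and u: "AE y in lborel. y \<in> U \<longrightarrow> u y = b"
  shows "entropy_condition_in U P \<rho> u"
  unfolding entropy_condition_in_def
proof (intro ballI allI impI)
  fix z s l r
  assume z: "z \<in> U" and "jump_at \<rho> u z s l r \<and> fst l > 0 \<and> fst r > 0"
  then obtain \<xi> C d where "l \<noteq> r" "d > 0" and lip: "C-lipschitz_on {fst z - d..fst z + d} \<xi>"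
    and \<xi>: "\<xi> (fst z) = snd z"
    and lim: "ess_limit \<rho> (fst l) z {(t, x). \<bar>t - fst z\<bar> < d \<and> x < \<xi> t}"
      "ess_limit u (snd l) z {(t, x). \<bar>t - fst z\<bar> < d \<and> x < \<xi> t}"
      "ess_limit \<rho> (fst r) z {(t, x). \<bar>t - fst z\<bar> < d \<and> x > \<xi> t}"
      "ess_limit u (snd r) z {(t, x). \<bar>t - fst z\<bar> < d \<and> x > \<xi> t}"
    unfolding jump_at_def by blast
  \<comment> \<open>\<open>\<xi>\<close> is controlled only near \<open>fst z\<close>; inside this
    open strip both sides are preimages of open sets under a continuous function.\<close>
  let ?D = "{fst z - d<..<fst z + d} \<times> (UNIV :: real set)"
  have "open ?D"
    by (intro open_Times) auto
  moreover have "continuous_on ?D (\<lambda>y. snd y - \<xi> (fst y))"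
    by (intro continuous_intros continuous_on_compose2[OF lipschitz_on_continuous_on[OF lip]]) auto
  ultimately have "open (?D \<inter> (\<lambda>y. snd y - \<xi> (fst y)) -` {..<0})"
    and "open (?D \<inter> (\<lambda>y. snd y - \<xi> (fst y)) -` {0<..})"
    by (auto intro!: continuous_open_preimage)
  moreover have "?D \<inter> (\<lambda>y. snd y - \<xi> (fst y)) -` {..<0} = {(t, x). \<bar>t - fst z\<bar> < d \<and> x < \<xi> t}"
    and "?D \<inter> (\<lambda>y. snd y - \<xi> (fst y)) -` {0<..} = {(t, x). \<bar>t - fst z\<bar> < d \<and> x > \<xi> t}"
    by (auto simp: abs_less_iff)
  ultimately have op: "open {(t, x). \<bar>t - fst z\<bar> < d \<and> x < \<xi> t}" "open {(t, x). \<bar>t - fst z\<bar> < d \<and> x > \<xi> t}"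
    by simp_all
  have cl: "z \<in> closure {(t, x). \<bar>t - fst z\<bar> < d \<and> x < \<xi> t}" "z \<in> closure {(t, x). \<bar>t - fst z\<bar> < d \<and> x > \<xi> t}"
    unfolding closure_approachable
  proof safe
    fix e :: real
    assume "e > 0"
    then show "\<exists>y \<in> {(t, x). \<bar>t - fst z\<bar> < d \<and> x < \<xi> t}. dist y z < e"
      using \<xi> \<open>d > 0\<close>
      by (intro bexI[of _ "(fst z, snd z - e / 2)"]) (auto simp: dist_prod_def dist_real_def)
    from \<open>e > 0\<close> show "\<exists>y \<in> {(t, x). \<bar>t - fst z\<bar> < d \<and> x > \<xi> t}. dist y z < e"
      using \<xi> \<open>d > 0\<close>
      by (intro bexI[of _ "(fst z, snd z + e / 2)"]) (auto simp: dist_prod_def dist_real_def)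
  qed
  have "fst l = a" "snd l = b" "fst r = a" "snd r = b"
    using ess_limit_const[OF lim(1) \<rho> \<open>open U\<close> z op(1) cl(1)] ess_limit_const[OF lim(2) u \<open>open U\<close> z op(1) cl(1)]
      ess_limit_const[OF lim(3) \<rho> \<open>open U\<close> z op(2) cl(2)] ess_limit_const[OF lim(4) u \<open>open U\<close> z op(2) cl(2)]
    by auto
  with \<open>l \<noteq> r\<close> show "lax_condition P s l r"
    by (simp add: prod_eq_iff)
qed

text \<open>A Radon-Nikodym derivative is determined only up to \<open>\<tau>\<close>-null sets, so
  every version of \<open>u\<close> is treated; the first conjunct keeps this from being
  vacuous.\<close>

theorem mainTheorem3:
  fixes \<alpha> M0 :: real
    and \<tau> m n \<pp> :: signed_measure
    and w\<^sub>\<rho> w\<^sub>p :: "real \<Rightarrow> real"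
  assumes "0 < \<alpha>" and "\<alpha> \<le> 1" and "M0 \<ge> sqrt (inverse \<alpha>)"
    and "w\<^sub>\<rho> = (\<lambda>t. sqrt 2 * t)"
    and "w\<^sub>p = (\<lambda>t. 2 - 2 / (\<alpha> * M0\<^sup>2))"
    and "\<tau> = signed_sum (lebesgue_times (indicator Omega)) (dirac_curve \<infinity> (\<lambda>_. 0) w\<^sub>\<rho>)"
    and "m = lebesgue_times (\<lambda>z. sqrt 2 * indicator Omega z)"
    and "n = lebesgue_times (\<lambda>z. 2 * indicator Omega z)"
    and "\<pp> = lebesgue_times (\<lambda>z. - 2 / (\<alpha> * M0\<^sup>2) * indicator Omega z)"
  shows "(\<exists>u. has_RN_deriv m \<tau> u) \<and>
    (\<forall>u. has_RN_deriv m \<tau> u \<longrightarrow>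
       measure_solution (limit_pressure \<alpha> M0) 1 (sqrt 2) \<tau> m n \<pp> u w\<^sub>p)"
proof (intro conjI allI impI)
  have w: "w\<^sub>\<rho> \<in> borel_measurable borel" "continuous_on UNIV w\<^sub>\<rho>" "\<And>t. t \<ge> 0 \<Longrightarrow> w\<^sub>\<rho> t \<ge> 0"
    unfolding assms(4) by (auto intro!: continuous_intros)
  show "\<exists>u. has_RN_deriv m \<tau> u"
    unfolding assms(6,7) using has_RN_deriv_sum_dirac_axis[OF w(1,3)] by blast
  fix u
  assume u: "has_RN_deriv m \<tau> u"
  have "inverse \<alpha> = (sqrt (inverse \<alpha>))\<^sup>2"
    using assms(1) by simp
  also have "\<dots> \<le> M0\<^sup>2"
    using assms(1,3) by (intro power_mono) auto
  finally have "1 \<le> \<alpha> * M0\<^sup>2"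
    using assms(1) by (simp add: field_simps)
  \<comment> \<open>The pressure of the state with density 1; then \<open>2 + c\<close> is the
    momentum flux into the piston.\<close>
  define c where "c = - 2 / (\<alpha> * M0\<^sup>2)"
  have wp: "w\<^sub>p = (\<lambda>_. 2 + c)" "2 + c \<ge> 0"
    using \<open>1 \<le> \<alpha> * M0\<^sup>2\<close> by (auto simp: assms(5) c_def field_simps)
  have \<pp>: "\<pp> = lebesgue_times (\<lambda>z. c * indicator Omega z)"
    by (simp add: assms(9) c_def)
  have sub: "Omega \<subseteq> closure Omega"
    by (rule closure_subset)
  have radon0: "radon_measure_on (closure Omega) (lebesgue_times (\<lambda>z. a * indicator Omega z))" for a
    by (rule radon_measure_on_lebesgue_times[OF Omega_borel sub])
  have L: "radon_measure_on (closure Omega) (lebesgue_times (indicator Omega))"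
    "nonneg_measure (lebesgue_times (indicator Omega))"
    using radon0[of 1] by (simp_all add: nonneg_measure_lebesgue_times)
  have D: "radon_measure_on (closure Omega) (dirac_curve \<infinity> (\<lambda>_. 0) w\<^sub>\<rho>)"
    "nonneg_measure (dirac_curve \<infinity> (\<lambda>_. 0) w\<^sub>\<rho>)"
    using radon_measure_on_dirac_curve_axis[OF w(2,3)] nonneg_measure_dirac_curve_axis[OF w(1,3)] by auto
  have \<tau>: "radon_measure_on (closure Omega) \<tau>" "nonneg_measure \<tau>"
    unfolding assms(6) using L D radon_measure_on_signed_sum nonneg_measure_signed_sum by blast+
  then have s\<tau>: "sets (fst \<tau>) = sets borel" "sets (snd \<tau>) = sets borel"
    by (auto simp: radon_measure_on_def)
  have [measurable]: "u \<in> borel_measurable borel"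
    using u by (simp add: has_RN_deriv_def)
  have ind: "indicator A z * indicator A z = (indicator A z :: real)"
    "(a * indicator A z) * indicator A z = (a * indicator A z :: real)" for a z and A :: "(real \<times> real) set"
    by (auto split: split_indicator)
  have "has_RN_deriv (restrict_signed Omega m) (restrict_signed Omega \<tau>) u"
    by (rule has_RN_deriv_restrict[OF u s\<tau> Omega_borel])
  then have "has_RN_deriv (lebesgue_times (\<lambda>z. sqrt 2 * indicator Omega z)) (lebesgue_times (indicator Omega)) u"
    by (simp add: assms(6,7) restrict_lebesgue_times restrict_sum_dirac_axis w(1) ind)
  then have u2: "AE z in lborel. z \<in> Omega \<longrightarrow> u z = sqrt 2"
    by (rule lebesgue_times_deriv_unique[OF Omega_borel])
  show "measure_solution (limit_pressure \<alpha> M0) 1 (sqrt 2) \<tau> m n \<pp> u w\<^sub>p"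
    unfolding measure_solution_def
  proof (intro conjI allI impI ballI)
    show "radon_measure_on (closure Omega) \<tau>" by fact
    show "radon_measure_on (closure Omega) m" "radon_measure_on (closure Omega) n"
      "radon_measure_on (closure Omega) \<pp>"
      unfolding assms(7,8) \<pp> by (rule radon0)+
    show "set_integrable lborel {0..T} w\<^sub>p" for T
      unfolding wp(1) by (rule borel_integrable_atLeastAtMost') simp
    show "w\<^sub>p t \<ge> 0" for t
      using wp by simp
    show "has_RN_deriv m \<tau> u" by fact
    \<comment> \<open>On \<open>Omega\<close> this is \<open>sqrt 2 * sqrt 2 = 2\<close>; elsewhere
      both sides vanish with the indicator.\<close>
    show "has_RN_deriv n m u"
      unfolding assms(7,8)
    proof (rule has_RN_deriv_lebesgue_times)
      show "AE z in lborel. 2 * indicator Omega z = sqrt 2 * indicator Omega z * u z"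
        using u2 by eventually_elim (auto split: split_indicator)
    qed auto
  next
    fix \<phi>
    assume \<phi>: "\<phi> \<in> C01"
    note [measurable] = C01_continuous[OF \<phi>, THEN borel_measurable_continuous_onI]
    note I = C01_integrals[OF \<phi>]
    have pair: "pairing (lebesgue_times (\<lambda>z. a * indicator Omega z)) f = a * (LINT z:Omega|lborel. f z)"
      if "f \<in> borel_measurable borel" for a f
      using that by (rule pairing_lebesgue_times[OF Omega_borel])
    have "pairing \<tau> (dt \<phi>) = pairing (lebesgue_times (indicator Omega)) (dt \<phi>)
        + pairing (dirac_curve \<infinity> (\<lambda>_. 0) w\<^sub>\<rho>) (dt \<phi>)"
      unfolding assms(6)
    proof (rule pairing_signed_sum[OF L(1) D(1) L(2) D(2)])
      show "integrable (fst (lebesgue_times (indicator Omega))) (dt \<phi>)"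
        using integrable_mult_indicator[OF _ I(1), of Omega]
        by (simp add: lebesgue_times_def integrable_density)
      show "integrable (fst (dirac_curve \<infinity> (\<lambda>_. 0) w\<^sub>\<rho>)) (dt \<phi>)"
        using set_integrable_mult_right[OF I(5), of "sqrt 2"]
        by (simp add: dirac_curve_def integral_dirac_part_axis(2) w assms(4) mult.assoc)
    qed simp
    also have "\<dots> = (LINT z:Omega|lborel. dt \<phi> z) + (LINT t:{0..}|lborel. sqrt 2 * (t * dt \<phi> (t, 0)))"
      using pair[of "dt \<phi>" 1] by (simp add: pairing_dirac_curve_axis w) (simp add: assms(4) mult.assoc)
    finally have \<tau>\<phi>: "pairing \<tau> (dt \<phi>) =
        - (LINT x:{..0}|lborel. \<phi> (0, x)) - sqrt 2 * (LINT t:{0..}|lborel. \<phi> (t, 0))"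
      by (simp add: I)
    \<comment> \<open>The flux term yields \<open>sqrt 2\<close> times the integral of \<phi> along
      the piston and cancels the contribution of the Dirac mass.\<close>
    show "pairing \<tau> (dt \<phi>) + pairing m (dx \<phi>) + (LINT x:{..0}|lborel. 1 * \<phi> (0, x)) = 0"
      unfolding \<tau>\<phi> assms(7) by (simp add: pair I)
    have "pairing (dirac_curve \<infinity> (\<lambda>_. 0) w\<^sub>p) \<phi> = (2 + c) * (LINT t:{0..}|lborel. \<phi> (t, 0))"
      by (simp add: pairing_dirac_curve_axis wp)
    \<comment> \<open>Along the piston \<open>n\<close> contributes 2 and \<open>\<pp>\<close>
      contributes \<open>c\<close>, balancing the weight; the time derivative cancels the initial
      momentum.\<close>
    then show "pairing m (dt \<phi>) + pairing n (dx \<phi>) + pairing \<pp> (dx \<phi>)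
          - pairing (dirac_curve \<infinity> (\<lambda>_. 0) w\<^sub>p) \<phi>
          + (LINT x:{..0}|lborel. 1 * sqrt 2 * \<phi> (0, x)) = 0"
      unfolding assms(7,8) \<pp> by (simp add: pair I) (simp add: algebra_simps)
  next
    fix z V \<rho> p
    assume A: "z \<in> {0..} \<times> {..0} \<and> open V \<and> z \<in> V \<and>
      has_lebesgue_density_in (V \<inter> closure Omega) \<tau> \<rho> \<and> has_lebesgue_density_in (V \<inter> closure Omega) \<pp> p"
    let ?W = "V \<inter> Omega"
    have W: "open ?W" "V \<inter> closure Omega \<in> sets borel" "?W \<subseteq> V \<inter> closure Omega" "?W \<subseteq> Omega"
      using A open_Omega sub by auto
    then have [measurable]: "?W \<in> sets borel" by simp
    have indW: "indicator Omega z * indicator ?W z = (indicator ?W z :: real)"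
      "a * indicator Omega z * indicator ?W z = (a * indicator ?W z :: real)" for a z
      by (auto split: split_indicator)
    have "has_RN_deriv (lebesgue_times (\<lambda>z. 1 * indicator ?W z)) (lebesgue_times (indicator ?W)) \<rho>"
      using has_lebesgue_density_in_subset[OF _ s\<tau> W(2) _ W(3), of \<rho>] A
        restrict_sum_dirac_axis[OF w(1) _ _ W(4), of "indicator Omega"]
      by (simp add: assms(6)[symmetric] indW)
    then have \<rho>: "AE y in lborel. y \<in> ?W \<longrightarrow> \<rho> y = 1"
      by (intro lebesgue_times_deriv_unique) auto
    have "has_RN_deriv (lebesgue_times (\<lambda>z. c * indicator ?W z)) (lebesgue_times (indicator ?W)) p"
      using has_lebesgue_density_in_subset[OF _ _ _ W(2) _ W(3), of \<pp> p] A
      by (simp add: \<pp> restrict_lebesgue_times indW)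
    then have p: "AE y in lborel. y \<in> ?W \<longrightarrow> p y = c"
      by (intro lebesgue_times_deriv_unique) auto
    \<comment> \<open>In \<open>?W\<close> the claim reads
      \<open>c = limit_pressure \<alpha> M0 1\<close>.\<close>
    show "AE y in lborel. y \<in> V \<inter> closure Omega \<longrightarrow> p y = limit_pressure \<alpha> M0 (\<rho> y)"
      using \<rho> p AE_closure_Omega by eventually_elim (auto simp: limit_pressure_def c_def)
    show "entropy_condition_in ?W (limit_pressure \<alpha> M0) \<rho> u"
      using u2 by (intro entropy_condition_in_const[OF W(1) \<rho>, of _ "sqrt 2"]) (auto elim!: eventually_mono)
  qed
qed

end
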